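(* Let $(f_n)_{n\in\mathbb N}$ be a collection of diffeomorphisms in $\mathrm{Diff}^1_+([0,1])$, each different from the identity and without hyperbolic fixed points, and for each $n$ let $I_n$ be a fundamental domain of $f_n$. Assume that for all $i<n$ one of the following holds: $\mathrm{Supp}(f_n)\subset I_i$; or $\mathrm{Supp}(f_i)\subset I_n$; or the interiors of $\mathrm{Supp}(f_n)$ and $\mathrm{Supp}(f_i)$ are disjoint. Then the group $\langle f_n, n\in\mathbb N\rangle$ generated by the $f_n$ is $C^1$-close to the identity.
   Context: $\mathrm{Supp}(f)$ denotes the support of $f$, the closure of $\{x: f(x)\neq x\}$. A fundamental domain of $f$ is a segment with endpoints $x$ and $f(x)$ for some $x$ with $f(x)\neq x$. A diffeomorphism is without hyperbolic fixed points if its derivative equals $1$ at each of its fixed points. A group $G\subset \mathrm{Diff}^1_+([0,1])$ is $C^1$-close to the identity if there is a sequence $h_n\in \mathrm{Diff}^1_+([0,1])$ such that $h_n g h_n^{-1}\to \mathrm{id}$ in the $C^1$-topology for every $g\in G$. *)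

theory Defs
  imports "HOL-Analysis.Analysis"
begin

text \<open>Elements of Diff^1_+([0,1]) are represented as maps real => real that are the
identity outside [0,1], increasing C^1 bijections of [0,1] with positive derivative
(one-sided derivatives at the endpoints).\<close>

definition diff1p :: "(real \<Rightarrow> real) \<Rightarrow> bool" where
  "diff1p f \<longleftrightarrow> bij_betw f {0..1} {0..1} \<and> (\<forall>x. x \<notin> {0..1} \<longrightarrow> f x = x) \<and>
     mono_on {0..1} f \<and>
     (\<exists>f'. continuous_on {0..1} f' \<and>
        (\<forall>x\<in>{0..1}. (f has_real_derivative f' x) (at x within {0..1}) \<and> f' x > 0))"

definition d1 :: "(real \<Rightarrow> real) \<Rightarrow> real \<Rightarrow> real" where
  "d1 f x = (THE d. (f has_real_derivative d) (at x within {0..1}))"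

definition supp :: "(real \<Rightarrow> real) \<Rightarrow> real set" where
  "supp f = closure {x. f x \<noteq> x}"

definition fundamental_domain :: "(real \<Rightarrow> real) \<Rightarrow> real set \<Rightarrow> bool" where
  "fundamental_domain f I \<longleftrightarrow> (\<exists>x. f x \<noteq> x \<and> I = closed_segment x (f x))"

definition no_hyperbolic_fixed_points :: "(real \<Rightarrow> real) \<Rightarrow> bool" where
  "no_hyperbolic_fixed_points f \<longleftrightarrow>
     (\<forall>x\<in>{0..1}. f x = x \<longrightarrow> (f has_real_derivative 1) (at x within {0..1}))"

inductive_set gen_group :: "(real \<Rightarrow> real) set \<Rightarrow> (real \<Rightarrow> real) set" for F where
  gen_id: "id \<in> gen_group F"
| gen_mult: "g \<in> gen_group F \<Longrightarrow> f \<in> F \<Longrightarrow> f \<circ> g \<in> gen_group F"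
| gen_inv: "g \<in> gen_group F \<Longrightarrow> f \<in> F \<Longrightarrow> inv f \<circ> g \<in> gen_group F"

definition C1_tendsto_id :: "(nat \<Rightarrow> real \<Rightarrow> real) \<Rightarrow> bool" where
  "C1_tendsto_id \<phi> \<longleftrightarrow> (\<forall>\<epsilon>>0. \<forall>\<^sub>F n in sequentially. \<forall>x\<in>{0..1}.
       \<bar>\<phi> n x - x\<bar> < \<epsilon> \<and> \<bar>d1 (\<phi> n) x - 1\<bar> < \<epsilon>)"

definition C1_close_to_id :: "(real \<Rightarrow> real) set \<Rightarrow> bool" where
  "C1_close_to_id G \<longleftrightarrow> (\<exists>h :: nat \<Rightarrow> real \<Rightarrow> real. (\<forall>n. diff1p (h n)) \<and>
     (\<forall>g\<in>G. C1_tendsto_id (\<lambda>n. h n \<circ> g \<circ> inv (h n))))"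

end

theory Submission
  imports Defs
begin

text \<open>
  Conjugating \<open>f\<close> by a diffeomorphism with logarithmic derivative \<open>u + const\<close> replaces \<open>ln f'\<close> by
  \<open>u \<circ> f - u + ln f'\<close>, up to a change of variable. Since \<open>C\<^sup>1\<close>-convergence of the conjugates to the
  identity passes to products and inverses, it suffices to find, for every finite subfamily and
  every \<open>\<epsilon>\<close>, a continuous \<open>u\<close> making all these functions smaller than \<open>\<epsilon>\<close>.

  For a single \<open>f\<close> one takes the average of the first Birkhoff sums of \<open>ln f'\<close>: the error is a
  Birkhoff average of \<open>ln f'\<close>, which is uniformly small because orbits accumulate only at fixed
  points, where \<open>ln f' = 0\<close>. For a finite family one adds a map whose fundamental domain \<open>J\<close> is
  longest, so that every other map is supported either in \<open>J\<close> or off the support of the new one.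
  The solution for the new map is corrected on \<open>J\<close> to the solution for the other maps, and the
  correction is propagated along the orbit of \<open>J\<close> with slowly decaying coefficients, which makes it
  almost invariant. The values at the endpoints of \<open>J\<close> are matched by logarithmic bumps, almost
  invariant under all bi-Lipschitz maps fixing the endpoints.
\<close>

section \<open>Coboundaries and Birkhoff sums\<close>

abbreviation moved :: "('a \<Rightarrow> 'a) \<Rightarrow> 'a set" where
  "moved f \<equiv> {x. f x \<noteq> x}"

definition coboundary :: "('a \<Rightarrow> 'a) \<Rightarrow> ('a \<Rightarrow> 'b::ab_group_add) \<Rightarrow> 'a \<Rightarrow> 'b" where
  "coboundary f u x = u (f x) - u x"

definition birkhoff_sum :: "('a \<Rightarrow> 'a) \<Rightarrow> ('a \<Rightarrow> 'b::comm_monoid_add) \<Rightarrow> nat \<Rightarrow> 'a \<Rightarrow> 'b" where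
  "birkhoff_sum f \<psi> n x = (\<Sum>k<n. \<psi> ((f ^^ k) x))"

lemma coboundary_add: "coboundary f (\<lambda>x. u x + v x) x = coboundary f u x + coboundary f v x"
  by (simp add: coboundary_def)

lemma coboundary_cong_moved:
  assumes "inj f" and eq: "\<And>x. x \<in> moved f \<Longrightarrow> u x = v x"
  shows "coboundary f u x = coboundary f v x"
proof (cases "f x = x")
  case False
  then have "f x \<in> moved f" using \<open>inj f\<close> by (auto dest: injD)
  then show ?thesis using False eq by (simp add: coboundary_def)
qed (simp add: coboundary_def)

lemma funpow_fixed_point: "f x = x \<Longrightarrow> (f ^^ n) x = x"
  by (induction n) auto

lemma birkhoff_sum_fixed_point:
  fixes \<psi> :: "'a \<Rightarrow> 'b::semiring_1"
  assumes "f x = x"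
  shows "birkhoff_sum f \<psi> n x = of_nat n * \<psi> x"
  by (simp add: birkhoff_sum_def funpow_fixed_point[of f, OF assms])

lemma coboundary_birkhoff_sum:
  fixes \<psi> :: "'a \<Rightarrow> 'b::ab_group_add"
  shows "coboundary f (birkhoff_sum f \<psi> n) x = \<psi> ((f ^^ n) x) - \<psi> x"
proof -
  have "coboundary f (birkhoff_sum f \<psi> n) x = (\<Sum>k<n. \<psi> ((f ^^ Suc k) x) - \<psi> ((f ^^ k) x))"
    by (simp add: coboundary_def birkhoff_sum_def sum_subtractf funpow_swap1)
  also have "\<dots> = \<psi> ((f ^^ n) x) - \<psi> x"
    using sum_lessThan_telescope[of "\<lambda>k. \<psi> ((f ^^ k) x)" n] by simp
  finally show ?thesis .
qed

lemma continuous_on_funpow: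
  fixes f :: "'a::topological_space \<Rightarrow> 'a"
  assumes "continuous_on UNIV f"
  shows "continuous_on UNIV (f ^^ n)"
proof (induction n)
  case (Suc n)
  then show ?case
    using continuous_on_compose[OF Suc continuous_on_subset[OF assms]] by simp
qed (simp add: id_def)

lemma continuous_on_birkhoff_sum:
  fixes f :: "'a::topological_space \<Rightarrow> 'a" and \<psi> :: "'a \<Rightarrow> 'b::topological_comm_monoid_add"
  assumes "continuous_on UNIV f" "continuous_on UNIV \<psi>"
  shows "continuous_on UNIV (birkhoff_sum f \<psi> n)"
  unfolding birkhoff_sum_def
  by (intro continuous_on_sum continuous_on_compose2[OF assms(2) continuous_on_funpow[OF assms(1)]])
    auto

section \<open>Almost coboundaries of a monotone map\<close>

lemma coboundary_averaged_birkhoff_sums: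
  fixes \<psi> :: "'a \<Rightarrow> real"
  assumes "n > 0"
  shows "coboundary f (\<lambda>x. (\<Sum>k<n. birkhoff_sum f \<psi> (Suc k) x) / real n) x + \<psi> x =
    birkhoff_sum f \<psi> n (f x) / real n"
proof -
  have "coboundary f (\<lambda>x. (\<Sum>k<n. birkhoff_sum f \<psi> (Suc k) x) / real n) x =
      (\<Sum>k<n. coboundary f (birkhoff_sum f \<psi> (Suc k)) x) / real n"
    by (simp add: coboundary_def sum_subtractf diff_divide_distrib)
  also have "\<dots> = (\<Sum>k<n. \<psi> ((f ^^ k) (f x)) - \<psi> x) / real n"
    by (simp add: coboundary_birkhoff_sum funpow_swap1)
  also have "\<dots> = birkhoff_sum f \<psi> n (f x) / real n - \<psi> x"
    using assms by (simp add: birkhoff_sum_def sum_subtractf diff_divide_distrib)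
  finally show ?thesis by simp
qed

lemma abs_le_add_mult_abs_if_zeros_subset:
  fixes \<phi> \<psi> :: "'a::topological_space \<Rightarrow> real"
  assumes "compact S" "continuous_on UNIV \<phi>" "continuous_on UNIV \<psi>"
    and zeros: "\<And>x. \<phi> x = 0 \<Longrightarrow> \<psi> x = 0" and outside: "\<And>x. x \<notin> S \<Longrightarrow> \<psi> x = 0"
    and "\<epsilon> > 0"
  obtains C where "C \<ge> 0" "\<And>x. \<bar>\<psi> x\<bar> \<le> \<epsilon> + C * \<bar>\<phi> x\<bar>"
proof -
  define K where "K = S \<inter> {x. \<epsilon> \<le> \<bar>\<psi> x\<bar>}"
  have "closed {x. \<epsilon> \<le> \<bar>\<psi> x\<bar>}"
    by (intro closed_Collect_le continuous_intros assms)
  then have "compact K"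
    unfolding K_def using \<open>compact S\<close> by (rule compact_Int_closed[rotated])
  have nonzero: "\<phi> x \<noteq> 0" if "x \<in> K" for x
    using that zeros[of x] \<open>\<epsilon> > 0\<close> by (auto simp: K_def)
  have "bounded ((\<lambda>x. \<psi> x / \<phi> x) ` K)"
    using nonzero
    by (intro compact_imp_bounded compact_continuous_image \<open>compact K\<close> continuous_on_divide
        continuous_on_subset[OF assms(2)] continuous_on_subset[OF assms(3)]) auto
  then obtain C where C: "C > 0" "\<And>x. x \<in> K \<Longrightarrow> \<bar>\<psi> x / \<phi> x\<bar> \<le> C"
    unfolding bounded_pos by auto
  have "\<bar>\<psi> x\<bar> \<le> \<epsilon> + C * \<bar>\<phi> x\<bar>" for x
  proof (cases "x \<in> K")
    case True
    then have "\<bar>\<psi> x\<bar> \<le> C * \<bar>\<phi> x\<bar>"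
      using C(2) nonzero by (simp add: abs_divide divide_le_eq)
    then show ?thesis using \<open>\<epsilon> > 0\<close> by linarith
  next
    case False
    then have "\<bar>\<psi> x\<bar> \<le> \<epsilon>"
      using outside[of x] \<open>\<epsilon> > 0\<close> by (cases "x \<in> S") (auto simp: K_def)
    then show ?thesis using C(1) by (simp add: add_increasing2)
  qed
  then show ?thesis using that C(1) less_imp_le by blast
qed

lemma inj_maps_into_if_fixes_complement:
  assumes "inj f" "\<And>x. x \<notin> S \<Longrightarrow> f x = x" "x \<in> S"
  shows "f x \<in> S"
  using assms by (metis injD)

lemma mono_sum_abs_orbit_increments:
  fixes f :: "'a::linordered_idom \<Rightarrow> 'a"
  assumes "mono f"
  shows "(\<Sum>k<n. \<bar>f ((f ^^ k) x) - (f ^^ k) x\<bar>) = \<bar>(f ^^ n) x - x\<bar>"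
proof (cases "x \<le> f x")
  case True
  then have "(f ^^ k) x \<le> f ((f ^^ k) x)" for k
    using funpow_mono[OF assms True] by (simp add: funpow_swap1)
  moreover from this have "x \<le> (f ^^ n) x" by (induction n) (auto intro: order_trans)
  ultimately show ?thesis
    using sum_lessThan_telescope[of "\<lambda>k. (f ^^ k) x" n] by simp
next
  case False
  then have "f ((f ^^ k) x) \<le> (f ^^ k) x" for k
    using funpow_mono[OF assms, of "f x" x] by (simp add: funpow_swap1)
  moreover from this have "(f ^^ n) x \<le> x" by (induction n) (auto intro: order_trans)
  ultimately show ?thesis
    using sum_lessThan_telescope'[of "\<lambda>k. (f ^^ k) x" n] by simp
qed

lemma funpow_displacement_le:
  fixes f :: "real \<Rightarrow> real"
  assumes "inj f" and outside: "\<And>x. x \<notin> {a..b} \<Longrightarrow> f x = x"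
  shows "\<bar>(f ^^ n) x - x\<bar> \<le> \<bar>b - a\<bar>"
proof (cases "x \<in> {a..b}")
  case True
  have stays: "f y \<in> {a..b}" if "y \<in> {a..b}" for y
    using inj_maps_into_if_fixes_complement[OF assms that] .
  have "(f ^^ n) x \<in> {a..b}"
    by (induction n) (use True stays in \<open>simp_all del: atLeastAtMost_iff\<close>)
  then show ?thesis using True by auto
next
  case False
  then show ?thesis using outside by (simp add: funpow_fixed_point)
qed

text \<open>The orbits accumulate only at fixed points, where \<open>\<psi>\<close> vanishes; quantitatively, the
  displacements along an orbit add up to at most \<open>b - a\<close>.\<close>

lemma birkhoff_averages_uniform_limit_0:
  fixes f \<psi> :: "real \<Rightarrow> real"
  assumes "strict_mono f" "continuous_on UNIV f" and outside: "\<And>x. x \<notin> {a..b} \<Longrightarrow> f x = x"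
    and "continuous_on UNIV \<psi>" and zero: "\<And>x. f x = x \<Longrightarrow> \<psi> x = 0"
  shows "uniform_limit UNIV (\<lambda>n x. birkhoff_sum f \<psi> n x / real n) (\<lambda>_. 0) sequentially"
proof (rule uniform_limitI)
  fix \<epsilon> :: real assume "\<epsilon> > 0"
  have "continuous_on UNIV (\<lambda>x. f x - x)"
    by (intro continuous_intros assms)
  then obtain C where C: "C \<ge> 0" "\<And>x. \<bar>\<psi> x\<bar> \<le> \<epsilon>/2 + C * \<bar>f x - x\<bar>"
    by (rule abs_le_add_mult_abs_if_zeros_subset[OF compact_Icc[of a b] _ \<open>continuous_on UNIV \<psi>\<close>,
          where \<epsilon> = "\<epsilon>/2"]) (simp_all add: zero outside \<open>\<epsilon> > 0\<close>)
  have bound: "\<bar>birkhoff_sum f \<psi> n x\<bar> \<le> real n * (\<epsilon>/2) + C * \<bar>b - a\<bar>" for n x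
  proof -
    have "\<bar>birkhoff_sum f \<psi> n x\<bar> \<le> (\<Sum>k<n. \<epsilon>/2 + C * \<bar>f ((f ^^ k) x) - (f ^^ k) x\<bar>)"
      unfolding birkhoff_sum_def by (intro order_trans[OF sum_abs] sum_mono C)
    also have "\<dots> = real n * (\<epsilon>/2) + C * \<bar>(f ^^ n) x - x\<bar>"
      using mono_sum_abs_orbit_increments[OF strict_mono_mono[OF \<open>strict_mono f\<close>]]
      by (simp add: sum.distrib flip: sum_distrib_left)
    also have "\<dots> \<le> real n * (\<epsilon>/2) + C * \<bar>b - a\<bar>"
      using strict_mono_imp_inj_on[OF \<open>strict_mono f\<close>] outside C(1)
      by (intro add_left_mono mult_left_mono funpow_displacement_le) auto
    finally show ?thesis .
  qed
  have "\<forall>\<^sub>F n in sequentially. C * \<bar>b - a\<bar> / real n < \<epsilon>/2"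
    using \<open>\<epsilon> > 0\<close> by (intro order_tendstoD(2)[OF lim_const_over_n]) simp
  then show "\<forall>\<^sub>F n in sequentially. \<forall>x\<in>UNIV. dist (birkhoff_sum f \<psi> n x / real n) 0 < \<epsilon>"
    using eventually_gt_at_top[of 0]
  proof eventually_elim
    case (elim n)
    have "\<bar>birkhoff_sum f \<psi> n x / real n\<bar> < \<epsilon>" for x
    proof -
      have "\<bar>birkhoff_sum f \<psi> n x / real n\<bar> \<le> \<epsilon>/2 + C * \<bar>b - a\<bar> / real n"
        using bound[of n x] elim(2) by (simp add: field_simps)
      then show ?thesis using elim(1) by linarith
    qed
    then show ?case by simp
  qed
qed

lemma exists_almost_cobounding_function:
  fixes f \<psi> :: "real \<Rightarrow> real"
  assumes f: "strict_mono f" "continuous_on UNIV f" "\<And>x. x \<notin> {a..b} \<Longrightarrow> f x = x"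
    and \<psi>: "continuous_on UNIV \<psi>" "\<And>x. f x = x \<Longrightarrow> \<psi> x = 0" and "\<epsilon> > 0"
  obtains u where "continuous_on UNIV u" "\<And>x. f x = x \<Longrightarrow> u x = 0"
    "\<And>x. \<bar>coboundary f u x + \<psi> x\<bar> < \<epsilon>"
proof -
  have "uniform_limit UNIV (\<lambda>n x. birkhoff_sum f \<psi> n x / real n) (\<lambda>_. 0) sequentially"
    by (rule birkhoff_averages_uniform_limit_0[OF f \<psi>])
  from uniform_limitD[OF this \<open>\<epsilon> > 0\<close>] eventually_gt_at_top[of 0]
  have "\<forall>\<^sub>F n in sequentially. n > 0 \<and> (\<forall>x. \<bar>birkhoff_sum f \<psi> n x / real n\<bar> < \<epsilon>)"
    by eventually_elim simp
  then obtain n where n: "n > 0" "\<And>x. \<bar>birkhoff_sum f \<psi> n x / real n\<bar> < \<epsilon>"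
    using eventually_happens trivial_limit_sequentially by blast
  define u where "u = (\<lambda>x. (\<Sum>k<n. birkhoff_sum f \<psi> (Suc k) x) / real n)"
  show ?thesis
  proof
    show "continuous_on UNIV u"
      unfolding u_def using n(1) f(2) \<psi>(1)
      by (intro continuous_intros continuous_on_birkhoff_sum) auto
    show "u x = 0" if "f x = x" for x
      using \<psi>(2) that by (simp add: u_def birkhoff_sum_fixed_point)
    show "\<bar>coboundary f u x + \<psi> x\<bar> < \<epsilon>" for x
      using n(2)[of "f x"] by (simp only: u_def coboundary_averaged_birkhoff_sums[OF n(1)])
  qed
qed

section \<open>Almost invariant extensions from wandering sets\<close>

lemma monotone_funpow_above:
  assumes "transp R" "monotone R R f" "R p (f p)" "R p x" "k > 0"
  shows "R (f p) ((f ^^ k) x)"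
proof -
  have "R p ((f ^^ j) x)" for j
  proof (induction j)
    case (Suc j)
    then have "R (f p) ((f ^^ Suc j) x)" using assms(2) by (simp add: monotone_def)
    then show ?case using assms(1,3) by (rule transpD[rotated 2])
  qed (use assms in simp)
  then have "R (f p) (f ((f ^^ (k - 1)) x))" using assms(2) by (simp add: monotone_def)
  then show ?thesis using \<open>k > 0\<close> by (cases k) auto
qed

lemma fundamental_segment_wandering:
  fixes f :: "real \<Rightarrow> real"
  assumes "strict_mono f" "f p \<noteq> p" "k > 0"
  shows "x \<in> closed_segment p (f p) \<Longrightarrow> (f ^^ k) x \<notin> open_segment p (f p)"
    and "x \<in> open_segment p (f p) \<Longrightarrow> (f ^^ k) x \<notin> closed_segment p (f p)"
proof -
  have mono: "monotone (<) (<) f" "monotone (>) (>) f" "monotone (\<le>) (\<le>) f" "monotone (\<ge>) (\<ge>) f"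
    using \<open>strict_mono f\<close> strict_mono_mono[OF \<open>strict_mono f\<close>] by (auto simp: monotone_on_def)
  note above = monotone_funpow_above[OF _ mono(1) _ _ \<open>k > 0\<close>, of p x]
      monotone_funpow_above[OF _ mono(2) _ _ \<open>k > 0\<close>, of p x]
      monotone_funpow_above[OF _ mono(3) _ _ \<open>k > 0\<close>, of p x]
      monotone_funpow_above[OF _ mono(4) _ _ \<open>k > 0\<close>, of p x]
  show "(f ^^ k) x \<notin> open_segment p (f p)" if "x \<in> closed_segment p (f p)"
    using above(3,4) that \<open>f p \<noteq> p\<close>
    by (cases "p < f p") (auto simp: closed_segment_eq_real_ivl open_segment_eq_real_ivl)
  show "(f ^^ k) x \<notin> closed_segment p (f p)" if "x \<in> open_segment p (f p)"
    using above(1,2) that \<open>f p \<noteq> p\<close>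
    by (cases "p < f p") (auto simp: closed_segment_eq_real_ivl open_segment_eq_real_ivl)
qed

lemma fundamental_segment_subset_moved:
  fixes f :: "real \<Rightarrow> real"
  assumes "strict_mono f" "f p \<noteq> p"
  shows "closed_segment p (f p) \<subseteq> moved f"
proof
  fix x assume "x \<in> closed_segment p (f p)"
  then consider "x = p" | "x = f p" | "x \<in> open_segment p (f p)"
    by (auto simp: open_segment_def)
  then show "x \<in> moved f"
  proof cases
    case 2
    then show ?thesis using assms by (simp add: strict_mono_eq)
  next
    case 3
    then show ?thesis
      using fundamental_segment_wandering(2)[OF assms zero_less_one, of x]
        open_closed_segment[of x] by auto
  qed (use assms in simp)
qed

lemma homeomorphism_funpow_cancel:
  assumes "homeomorphism UNIV UNIV f g"
  shows "k \<le> l \<Longrightarrow> (f ^^ k) ((g ^^ l) x) = (g ^^ (l - k)) x"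
    and "l \<le> k \<Longrightarrow> (f ^^ k) ((g ^^ l) x) = (f ^^ (k - l)) x"
proof -
  have cancel: "(f ^^ k) ((g ^^ k) y) = y" for k y
    using homeomorphism_apply2[OF assms]
    by (induction k arbitrary: y) (simp_all add: funpow_swap1)
  show "(f ^^ k) ((g ^^ l) x) = (g ^^ (l - k)) x" if "k \<le> l"
    using cancel[of k "(g ^^ (l - k)) x"] that funpow_add[of k "l - k" g] by simp
  show "(f ^^ k) ((g ^^ l) x) = (f ^^ (k - l)) x" if "l \<le> k"
    using cancel[of l x] that funpow_add[of "k - l" l f] by simp
qed

text \<open>At most one point of an orbit lies in the wandering set \<open>{x. v x \<noteq> 0}\<close>.\<close>

lemma abs_birkhoff_sum_le_if_wandering:
  fixes v :: "'a \<Rightarrow> real"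
  assumes wandering: "\<And>k x. k > 0 \<Longrightarrow> v x \<noteq> 0 \<Longrightarrow> v ((f ^^ k) x) = 0"
    and bound: "\<And>x. \<bar>v x\<bar> \<le> B"
  shows "\<bar>birkhoff_sum f v n x\<bar> \<le> B"
proof (cases "\<exists>i<n. v ((f ^^ i) x) \<noteq> 0")
  case True
  then obtain i where i: "i < n" "v ((f ^^ i) x) \<noteq> 0" by blast
  have later: "v ((f ^^ l) x) = 0" if "k < l" "v ((f ^^ k) x) \<noteq> 0" for k l
    using wandering[of "l - k" "(f ^^ k) x"] that funpow_add[of "l - k" k f] by simp
  have "v ((f ^^ k) x) = 0" if "k \<noteq> i" for k
    using later[of i k] later[of k i] i(2) that by (cases "k < i") auto
  then have "birkhoff_sum f v n x = (\<Sum>k<n. if k = i then v ((f ^^ i) x) else 0)"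
    unfolding birkhoff_sum_def by (intro sum.cong) auto
  then show ?thesis using i(1) bound by simp
next
  case False
  then show ?thesis using abs_ge_zero[of "v x"] bound[of x] by (simp add: birkhoff_sum_def)
qed

lemma birkhoff_sum_backward_orbit_if_wandering:
  fixes v :: "'a::topological_space \<Rightarrow> real"
  assumes fg: "homeomorphism UNIV UNIV f g"
    and support: "\<And>x. v x \<noteq> 0 \<Longrightarrow> x \<in> C"
    and leaves: "\<And>k x. k > 0 \<Longrightarrow> v x \<noteq> 0 \<Longrightarrow> (f ^^ k) x \<notin> C"
    and avoids: "\<And>k x. k > 0 \<Longrightarrow> x \<in> C \<Longrightarrow> v ((f ^^ k) x) = 0"
    and "x \<in> C" "l < n"
  shows "birkhoff_sum f v n ((g ^^ l) x) = v x"
proof -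
  have "v ((f ^^ k) ((g ^^ l) x)) = (if k = l then v x else 0)" for k
  proof (cases k l rule: linorder_cases)
    case less
    have "(f ^^ (l - k)) ((g ^^ (l - k)) x) = x"
      using homeomorphism_funpow_cancel(1)[OF fg, of "l - k" "l - k" x] by simp
    then have "v ((g ^^ (l - k)) x) = 0"
      using leaves[of "l - k" "(g ^^ (l - k)) x"] less \<open>x \<in> C\<close> by auto
    then show ?thesis using less homeomorphism_funpow_cancel(1)[OF fg, of k l x] by simp
  next
    case equal
    then show ?thesis using homeomorphism_funpow_cancel(1)[OF fg, of l l x] by simp
  next
    case greater
    then show ?thesis
      using avoids[of "k - l" x] \<open>x \<in> C\<close> homeomorphism_funpow_cancel(2)[OF fg, of l k x] by simp
  qed
  then show ?thesis using \<open>l < n\<close> by (simp add: birkhoff_sum_def)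
qed

lemma abs_coboundary_backward_birkhoff_average_le:
  fixes s :: "'a \<Rightarrow> real"
  assumes "\<And>x. g (f x) = x" and bound: "\<And>x. \<bar>s x\<bar> \<le> B"
  shows "\<bar>coboundary f (\<lambda>x. birkhoff_sum g s n x / real n) x\<bar> \<le> 2 * B / real n"
proof -
  have "coboundary f (\<lambda>x. birkhoff_sum g s n x / real n) x =
      - coboundary g (birkhoff_sum g s n) (f x) / real n"
    using assms(1) by (simp add: coboundary_def diff_divide_distrib)
  also have "\<dots> = (s (f x) - s ((g ^^ n) (f x))) / real n"
    by (simp add: coboundary_birkhoff_sum)
  also have "\<bar>\<dots>\<bar> \<le> 2 * B / real n"
    using bound[of "f x"] bound[of "(g ^^ n) (f x)"] by (simp add: divide_right_mono)
  finally show ?thesis .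
qed

text \<open>The extension is \<open>\<Sum>\<^sub>j max 0 (1 - \<bar>j\<bar> / M) * v (f\<^sup>j x)\<close> over all integers \<open>j\<close>, written as an
  iterated Birkhoff sum over pairs of a forward and a backward iterate.\<close>

lemma exists_almost_invariant_extension:
  fixes v :: "'a::topological_space \<Rightarrow> real"
  assumes fg: "homeomorphism UNIV UNIV f g" and v: "continuous_on UNIV v" "\<And>x. \<bar>v x\<bar> \<le> B"
    and support: "\<And>x. v x \<noteq> 0 \<Longrightarrow> x \<in> C"
    and leaves: "\<And>k x. k > 0 \<Longrightarrow> v x \<noteq> 0 \<Longrightarrow> (f ^^ k) x \<notin> C"
    and avoids: "\<And>k x. k > 0 \<Longrightarrow> x \<in> C \<Longrightarrow> v ((f ^^ k) x) = 0"
    and "\<epsilon> > 0"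
  obtains V where "continuous_on UNIV V" "\<And>x. x \<in> C \<Longrightarrow> V x = v x"
    "\<And>x. f x = x \<Longrightarrow> V x = 0" "\<And>x. \<bar>coboundary f V x\<bar> < \<epsilon>"
proof -
  have "\<forall>\<^sub>F M in sequentially. M > 0 \<and> 2 * B / real M < \<epsilon>"
    using eventually_gt_at_top[of 0] order_tendstoD(2)[OF lim_const_over_n \<open>\<epsilon> > 0\<close>]
    by eventually_elim simp
  then obtain M :: nat where M: "M > 0" "2 * B / real M < \<epsilon>"
    using eventually_happens trivial_limit_sequentially by blast
  define s where "s = birkhoff_sum f v M"
  define V where "V = (\<lambda>x. birkhoff_sum g s M x / real M)"
  have s: "\<bar>s x\<bar> \<le> B" for x
    unfolding s_def
    by (rule abs_birkhoff_sum_le_if_wandering) (use support leaves v(2) in blast)+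
  show ?thesis
  proof
    have "continuous_on UNIV s"
      unfolding s_def by (intro continuous_on_birkhoff_sum homeomorphism_cont1[OF fg] v)
    then show "continuous_on UNIV V"
      unfolding V_def using M(1)
      by (intro continuous_intros continuous_on_birkhoff_sum homeomorphism_cont2[OF fg]) auto
    show "V x = v x" if "x \<in> C" for x
    proof -
      have "birkhoff_sum g s M x = (\<Sum>l<M. v x)"
        unfolding s_def birkhoff_sum_def[of g]
        using birkhoff_sum_backward_orbit_if_wandering[where v = v and C = C,
            OF fg support leaves avoids that]
        by (intro sum.cong) auto
      then show ?thesis using M(1) by (simp add: V_def)
    qed
    show "V x = 0" if "f x = x" for x
    proof -
      have "g x = x" using homeomorphism_apply1[OF fg, of x] that by simp
      moreover have "v x = 0" using leaves[of 1 x] support[of x] that by auto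
      ultimately show ?thesis
        using that by (simp add: V_def s_def birkhoff_sum_fixed_point)
    qed
    have "\<bar>coboundary f V x\<bar> \<le> 2 * B / real M" for x
      unfolding V_def using homeomorphism_apply1[OF fg] s
      by (intro abs_coboundary_backward_birkhoff_average_le) auto
    then show "\<bar>coboundary f V x\<bar> < \<epsilon>" for x
      using M(2) by (rule le_less_trans)
  qed
qed

lemma continuous_on_cut_to_segment:
  fixes v :: "real \<Rightarrow> 'a::real_normed_vector"
  assumes "continuous_on UNIV v" "v a = 0" "v b = 0"
  shows "continuous_on UNIV (\<lambda>x. if x \<in> closed_segment a b then v x else 0)"
proof -
  have "closed (- open_segment a b)" by (simp add: open_segment_eq_real_ivl closed_Compl)
  then have "continuous_on (closed_segment a b \<union> - open_segment a b)
      (\<lambda>x. if x \<in> closed_segment a b then v x else 0)"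
    by (intro continuous_on_cases continuous_on_subset[OF assms(1)])
      (auto simp: open_segment_def assms)
  moreover have "closed_segment a b \<union> - open_segment a b = UNIV"
    using open_closed_segment by blast
  ultimately show ?thesis by simp
qed

lemma exists_almost_invariant_extension_from_fundamental_segment:
  fixes f v :: "real \<Rightarrow> real"
  assumes "strict_mono f" "f p \<noteq> p" and fg: "homeomorphism UNIV UNIV f g"
    and v: "continuous_on UNIV v" "v p = 0" "v (f p) = 0" and "\<epsilon> > 0"
  obtains V where "continuous_on UNIV V" "\<And>x. x \<in> closed_segment p (f p) \<Longrightarrow> V x = v x"
    "\<And>x. f x = x \<Longrightarrow> V x = 0" "\<And>x. \<bar>coboundary f V x\<bar> < \<epsilon>"
proof -
  define C where "C = closed_segment p (f p)"
  define v' where "v' x = (if x \<in> C then v x else 0)" for x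
  have support: "x \<in> open_segment p (f p)" if "v' x \<noteq> 0" for x
    using that v(2,3) by (auto simp: v'_def C_def open_segment_def split: if_splits)
  have v': "continuous_on UNIV v'"
    unfolding v'_def C_def by (rule continuous_on_cut_to_segment[OF v])
  have "bounded (v ` C)"
    unfolding C_def
    by (intro compact_imp_bounded compact_continuous_image continuous_on_subset[OF v(1)]) auto
  then obtain B where "B > 0" "\<And>x. x \<in> C \<Longrightarrow> \<bar>v x\<bar> \<le> B"
    unfolding bounded_pos by auto
  then have bound: "\<bar>v' x\<bar> \<le> B" for x by (simp add: v'_def)
  note wandering = fundamental_segment_wandering[OF assms(1,2)]
  have leaves: "(f ^^ k) x \<notin> C" if "k > 0" "v' x \<noteq> 0" for k x
    unfolding C_def using wandering(2) support that by blast
  have avoids: "v' ((f ^^ k) x) = 0" if "k > 0" "x \<in> C" for k x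
    using wandering(1) support that unfolding C_def by blast
  obtain V where V: "continuous_on UNIV V" "\<And>x. x \<in> C \<Longrightarrow> V x = v' x"
      "\<And>x. f x = x \<Longrightarrow> V x = 0" "\<And>x. \<bar>coboundary f V x\<bar> < \<epsilon>"
    by (rule exists_almost_invariant_extension[OF fg v' bound _ leaves avoids \<open>\<epsilon> > 0\<close>])
      (auto simp: v'_def split: if_splits)
  then show ?thesis using that by (simp add: v'_def C_def)
qed

section \<open>Logarithmic bumps\<close>

text \<open>A map distorting distances to \<open>p\<close> by a factor at most \<open>K\<close> changes the bump at \<open>p\<close> by at
  most \<open>\<delta> * ln K\<close>, however small the support of the bump.\<close>

definition log_bump :: "real \<Rightarrow> real \<Rightarrow> 'a::metric_space \<Rightarrow> 'a \<Rightarrow> real" where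
  "log_bump \<delta> s p x = max 0 (1 - \<delta> * ln (max 1 (dist x p / s)))"

lemma continuous_on_log_bump: "s > 0 \<Longrightarrow> continuous_on A (log_bump \<delta> s p)"
  unfolding log_bump_def by (intro continuous_intros) auto

lemma log_bump_center [simp]: "log_bump \<delta> s p p = 1"
  by (simp add: log_bump_def)

lemma log_bump_eq_0:
  assumes "\<delta> > 0" "s > 0" "s * exp (1 / \<delta>) \<le> dist x p"
  shows "log_bump \<delta> s p x = 0"
proof -
  have "exp (1 / \<delta>) \<le> dist x p / s"
    using assms by (simp add: field_simps)
  then have "1 / \<delta> \<le> ln (max 1 (dist x p / s))"
    by (subst ln_ge_iff) auto
  then show ?thesis using \<open>\<delta> > 0\<close> by (simp add: log_bump_def field_simps)
qed

lemma abs_log_bump_diff_le: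
  assumes "\<delta> \<ge> 0" "s > 0" "K \<ge> 1"
    and "dist x p \<le> K * dist y p" "dist y p \<le> K * dist x p"
  shows "\<bar>log_bump \<delta> s p y - log_bump \<delta> s p x\<bar> \<le> \<delta> * ln K"
proof -
  define l where "l z = ln (max 1 (dist z p / s))" for z
  have l_le: "l z \<le> ln K + l z'" if "dist z p \<le> K * dist z' p" for z z'
  proof -
    have "dist z p / s \<le> K * (dist z' p / s)"
      using that \<open>s > 0\<close> by (simp add: field_simps)
    also have "\<dots> \<le> K * max 1 (dist z' p / s)"
      using \<open>K \<ge> 1\<close> by (intro mult_left_mono) auto
    moreover have "1 \<le> K * max 1 (dist z' p / s)"
      using mult_mono[of 1 K 1 "max 1 (dist z' p / s)"] \<open>K \<ge> 1\<close> by auto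
    ultimately have "l z \<le> ln (K * max 1 (dist z' p / s))"
      unfolding l_def by (subst ln_le_cancel_iff) auto
    also have "\<dots> = ln K + l z'"
      unfolding l_def using \<open>K \<ge> 1\<close> by (subst ln_mult) auto
    finally show ?thesis .
  qed
  have "\<bar>\<delta> * l y - \<delta> * l x\<bar> = \<delta> * \<bar>l y - l x\<bar>"
    using \<open>\<delta> \<ge> 0\<close> by (simp add: abs_mult flip: right_diff_distrib)
  also have "\<dots> \<le> \<delta> * ln K"
    using l_le[OF assms(4)] l_le[OF assms(5)] \<open>\<delta> \<ge> 0\<close> by (intro mult_left_mono) auto
  finally show ?thesis unfolding log_bump_def l_def[symmetric] by linarith
qed

lemma finite_lipschitz_constant:
  assumes "finite F" "\<And>g. g \<in> F \<Longrightarrow> \<exists>L. L-lipschitz_on S g"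
  obtains L where "L \<ge> 1" "\<And>g. g \<in> F \<Longrightarrow> L-lipschitz_on S g"
proof -
  obtain l where l: "\<And>g. g \<in> F \<Longrightarrow> (l g)-lipschitz_on S g"
    using assms(2) by metis
  define L where "L = Max (insert 1 (l ` F))"
  have "L \<ge> 1" "\<And>g. g \<in> F \<Longrightarrow> l g \<le> L"
    using \<open>finite F\<close> by (auto simp: L_def)
  then show ?thesis using that l lipschitz_on_mono[OF _ order_refl] by metis
qed

lemma exists_almost_invariant_bump:
  fixes p :: "'a::metric_space" and r \<epsilon> :: real
  assumes "finite F" and bij: "\<And>g. g \<in> F \<Longrightarrow> bij g"
    and lipschitz: "\<And>g. g \<in> F \<Longrightarrow> \<exists>L. L-lipschitz_on UNIV g"
      "\<And>g. g \<in> F \<Longrightarrow> \<exists>L. L-lipschitz_on UNIV (inv g)"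
    and fixed: "\<And>g. g \<in> F \<Longrightarrow> g p = p" and "r > 0" "\<epsilon> > 0"
  obtains w where "continuous_on UNIV w" "w p = 1" "\<And>x. r \<le> dist x p \<Longrightarrow> w x = 0"
    "\<And>g x. g \<in> F \<Longrightarrow> \<bar>coboundary g w x\<bar> < \<epsilon>"
proof -
  obtain K where K: "K \<ge> 1" "\<And>g. g \<in> F \<union> inv ` F \<Longrightarrow> K-lipschitz_on UNIV g"
    by (rule finite_lipschitz_constant[of "F \<union> inv ` F" UNIV])
      (use \<open>finite F\<close> lipschitz in auto)
  define \<delta> where "\<delta> = \<epsilon> / (ln K + 1)"
  have "ln K + 1 > 0" using K(1) by (simp add: add_nonneg_pos)
  then have \<delta>: "\<delta> > 0" "\<delta> * ln K < \<epsilon>"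
    using \<open>\<epsilon> > 0\<close> by (simp_all add: \<delta>_def field_simps)
  define s where "s = r / exp (1 / \<delta>)"
  have "s > 0" using \<open>r > 0\<close> by (simp add: s_def)
  show ?thesis
  proof
    show "continuous_on UNIV (log_bump \<delta> s p)"
      using \<open>s > 0\<close> by (rule continuous_on_log_bump)
    show "log_bump \<delta> s p x = 0" if "r \<le> dist x p" for x
      using \<delta>(1) \<open>s > 0\<close> that by (intro log_bump_eq_0) (simp_all add: s_def)
    show "\<bar>coboundary g (log_bump \<delta> s p) x\<bar> < \<epsilon>" if "g \<in> F" for g x
    proof -
      have "dist (g x) p \<le> K * dist x p"
        using lipschitz_onD[OF K(2), of g x p] fixed[OF that] that by simp
      moreover have "inv g (g x) = x" "inv g p = p"
        using bij[OF that] fixed[OF that] by (simp_all add: bij_is_inj inv_f_eq)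
      then have "dist x p \<le> K * dist (g x) p"
        using lipschitz_onD[OF K(2), of "inv g" "g x" p] that by simp
      ultimately show ?thesis
        using abs_log_bump_diff_le[of \<delta> s K x p "g x"] \<delta> \<open>s > 0\<close> K(1)
        by (simp add: coboundary_def)
    qed
  qed simp
qed

lemma exists_almost_invariant_interpolation:
  fixes a b :: "'a::metric_space" and \<alpha> \<beta> \<epsilon> :: real
  assumes "finite F" "\<And>g. g \<in> F \<Longrightarrow> bij g"
    and "\<And>g. g \<in> F \<Longrightarrow> \<exists>L. L-lipschitz_on UNIV g"
      "\<And>g. g \<in> F \<Longrightarrow> \<exists>L. L-lipschitz_on UNIV (inv g)"
    and fixed: "\<And>g. g \<in> F \<Longrightarrow> g a = a" "\<And>g. g \<in> F \<Longrightarrow> g b = b" and "a \<noteq> b" "\<epsilon> > 0"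
  obtains w where "continuous_on UNIV w" "w a = \<alpha>" "w b = \<beta>"
    "\<And>g x. g \<in> F \<Longrightarrow> \<bar>coboundary g w x\<bar> < \<epsilon>"
proof -
  define \<eta> where "\<eta> = \<epsilon> / (1 + \<bar>\<alpha>\<bar> + \<bar>\<beta>\<bar>)"
  have \<eta>: "\<eta> > 0" "(1 + \<bar>\<alpha>\<bar> + \<bar>\<beta>\<bar>) * \<eta> = \<epsilon>"
    using \<open>\<epsilon> > 0\<close> abs_ge_zero[of \<alpha>] abs_ge_zero[of \<beta>] by (simp_all add: \<eta>_def)
  have "dist a b > 0" using \<open>a \<noteq> b\<close> by simp
  note bump = exists_almost_invariant_bump[OF assms(1-4) _ this \<eta>(1)]
  obtain wa where wa: "continuous_on UNIV wa" "wa a = 1" "\<And>x. dist a b \<le> dist x a \<Longrightarrow> wa x = 0"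
      "\<And>g x. g \<in> F \<Longrightarrow> \<bar>coboundary g wa x\<bar> < \<eta>"
    by (rule bump[of a]) (use fixed in auto)
  obtain wb where wb: "continuous_on UNIV wb" "wb b = 1" "\<And>x. dist a b \<le> dist x b \<Longrightarrow> wb x = 0"
      "\<And>g x. g \<in> F \<Longrightarrow> \<bar>coboundary g wb x\<bar> < \<eta>"
    by (rule bump[of b]) (use fixed in auto)
  define w where "w x = \<alpha> * wa x + \<beta> * wb x" for x
  show ?thesis
  proof
    show "continuous_on UNIV w" unfolding w_def by (intro continuous_intros wa wb)
    show "w a = \<alpha>" "w b = \<beta>" using wa(2,3) wb(2,3) by (simp_all add: w_def dist_commute)
    show "\<bar>coboundary g w x\<bar> < \<epsilon>" if "g \<in> F" for g x
    proof -
      have "coboundary g w x = \<alpha> * coboundary g wa x + \<beta> * coboundary g wb x"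
        by (simp add: w_def coboundary_def algebra_simps)
      also have "\<bar>\<dots>\<bar> \<le> \<bar>\<alpha>\<bar> * \<bar>coboundary g wa x\<bar> + \<bar>\<beta>\<bar> * \<bar>coboundary g wb x\<bar>"
        by (rule order_trans[OF abs_triangle_ineq]) (simp add: abs_mult)
      also have "\<dots> \<le> \<bar>\<alpha>\<bar> * \<eta> + \<bar>\<beta>\<bar> * \<eta>"
        using wa(4)[OF that, of x] wb(4)[OF that, of x] by (intro add_mono mult_left_mono) auto
      also have "\<dots> < (1 + \<bar>\<alpha>\<bar> + \<bar>\<beta>\<bar>) * \<eta>"
        using \<eta>(1) by (simp add: algebra_simps)
      finally show ?thesis by (simp add: \<eta>(2))
    qed
  qed
qed

section \<open>Nested families\<close>

definition subordinate :: "(real \<Rightarrow> real) \<Rightarrow> (real \<Rightarrow> real) \<Rightarrow> real \<Rightarrow> bool" where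
  "subordinate g f p \<longleftrightarrow> moved g \<subseteq> open_segment p (f p) \<or> moved g \<inter> moved f = {}"

locale nested_family =
  fixes f \<psi> :: "'i \<Rightarrow> real \<Rightarrow> real" and p :: "'i \<Rightarrow> real" and a b :: real
  assumes strict_mono: "strict_mono (f i)"
    and bij: "bij (f i)"
    and fixes_outside: "x \<notin> {a..b} \<Longrightarrow> f i x = x"
    and lipschitz: "\<exists>L. L-lipschitz_on UNIV (f i)"
    and lipschitz_inv: "\<exists>L. L-lipschitz_on UNIV (inv (f i))"
    and continuous_cocycle: "continuous_on UNIV (\<psi> i)"
    and cocycle_fixed_point: "f i x = x \<Longrightarrow> \<psi> i x = 0"
    and base_point_moved: "f i (p i) \<noteq> p i"
    and nested: "i \<noteq> j \<Longrightarrow> subordinate (f i) (f j) (p j) \<or> subordinate (f j) (f i) (p i)"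
begin

abbreviation fundamental_segment :: "'i \<Rightarrow> real set" where
  "fundamental_segment i \<equiv> closed_segment (p i) (f i (p i))"

definition approx_solution :: "real \<Rightarrow> 'i set \<Rightarrow> (real \<Rightarrow> real) \<Rightarrow> bool" where
  "approx_solution \<epsilon> A u \<longleftrightarrow> continuous_on UNIV u \<and> (\<forall>x. (\<forall>i\<in>A. f i x = x) \<longrightarrow> u x = 0) \<and>
    (\<forall>i\<in>A. \<forall>x. \<bar>coboundary (f i) u x + \<psi> i x\<bar> < \<epsilon>)"

lemma approx_solutionD:
  assumes "approx_solution \<epsilon> A u"
  shows "continuous_on UNIV u" "(\<And>i. i \<in> A \<Longrightarrow> f i x = x) \<Longrightarrow> u x = 0"
    "i \<in> A \<Longrightarrow> \<bar>coboundary (f i) u x + \<psi> i x\<bar> < \<epsilon>"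
  using assms by (auto simp: approx_solution_def)

lemma fundamental_segment_moved: "fundamental_segment i \<subseteq> moved (f i)"
  by (rule fundamental_segment_subset_moved[OF strict_mono base_point_moved])

lemma homeomorphism_inv: "homeomorphism UNIV UNIV (f i) (inv (f i))"
  using lipschitz lipschitz_inv bij[of i]
  by (auto simp: homeomorphism_def bij_is_inj bij_is_surj surj_f_inv_f surj_imp_inj_inv
      inj_imp_surj_inv intro: lipschitz_on_continuous_on)

lemma exists_approx_solution_singleton:
  assumes "\<epsilon> > 0"
  obtains u where "approx_solution \<epsilon> {i} u"
proof -
  obtain u where "continuous_on UNIV u" "\<And>x. f i x = x \<Longrightarrow> u x = 0"
      "\<And>x. \<bar>coboundary (f i) u x + \<psi> i x\<bar> < \<epsilon>"
    using exists_almost_cobounding_function[of "f i" a b "\<psi> i" \<epsilon>] strict_mono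
      homeomorphism_cont1[OF homeomorphism_inv] fixes_outside continuous_cocycle cocycle_fixed_point
      \<open>\<epsilon> > 0\<close> by blast
  then have "approx_solution \<epsilon> {i} u" by (simp add: approx_solution_def)
  then show ?thesis by (rule that)
qed

lemma subordinate_longest:
  assumes "i \<noteq> m" and longest: "\<bar>f i (p i) - p i\<bar> \<le> \<bar>f m (p m) - p m\<bar>"
  shows "subordinate (f i) (f m) (p m)"
proof (rule ccontr)
  assume "\<not> ?thesis"
  then have "moved (f m) \<subseteq> open_segment (p i) (f i (p i))"
    using nested[OF \<open>i \<noteq> m\<close>] unfolding subordinate_def by blast
  then have "p m \<in> open_segment (p i) (f i (p i))" "f m (p m) \<in> open_segment (p i) (f i (p i))"
    using fundamental_segment_moved[of m] by auto
  then have "\<bar>f m (p m) - p m\<bar> < \<bar>f i (p i) - p i\<bar>"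
    by (auto simp: open_segment_eq_real_ivl split: if_splits)
  then show False using longest by simp
qed

text \<open>On the fundamental segment of \<open>f m\<close> the glued function is \<open>u\<^sub>A + w\<close>, elsewhere on the
  support of \<open>f m\<close> it is \<open>u\<^sub>m + V\<close>, and off that support it is \<open>u\<^sub>A\<close>.\<close>

lemma approx_solution_glue:
  assumes "\<epsilon> > 0" and uA: "approx_solution (\<epsilon>/2) A uA" and um: "approx_solution (\<epsilon>/2) {m} um"
    and subordinate: "\<And>i. i \<in> A \<Longrightarrow> subordinate (f i) (f m) (p m)"
    and V: "continuous_on UNIV V" "\<And>x. x \<in> fundamental_segment m \<Longrightarrow> V x = uA x + w x - um x"
      "\<And>x. f m x = x \<Longrightarrow> V x = 0" "\<And>x. \<bar>coboundary (f m) V x\<bar> < \<epsilon>/2"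
    and w: "\<And>i x. i \<in> A \<Longrightarrow> \<bar>coboundary (f i) w x\<bar> < \<epsilon>/2"
  shows "approx_solution \<epsilon> (insert m A)
    (\<lambda>x. um x + V x + (uA x - (if x \<in> fundamental_segment m then uA x else 0)))"
    (is "approx_solution _ _ ?u")
proof -
  have uA_zero: "uA x = 0" if "x \<in> moved (f m)" "x \<notin> open_segment (p m) (f m (p m))" for x
    using subordinate that unfolding subordinate_def by (intro approx_solutionD(2)[OF uA]) blast
  have on_segment: "?u x = uA x + w x" if "x \<in> open_segment (p m) (f m (p m))" for x
    using V(2) that open_closed_segment[of x] by simp
  have off_m: "?u x = uA x" if "x \<notin> moved (f m)" for x
    using approx_solutionD(2)[OF um] V(3) fundamental_segment_moved[of m] that by auto
  have on_m: "?u x = um x + V x" if "x \<in> moved (f m)" for x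
    using uA_zero[OF that] open_closed_segment[of x] by auto
  have "\<bar>coboundary (f m) ?u x + \<psi> m x\<bar> < \<epsilon>" for x
  proof -
    have "coboundary (f m) ?u x = coboundary (f m) (\<lambda>x. um x + V x) x"
      by (rule coboundary_cong_moved[OF bij_is_inj[OF bij] on_m])
    also have "\<dots> = coboundary (f m) um x + coboundary (f m) V x" by (rule coboundary_add)
    finally show ?thesis using approx_solutionD(3)[OF um singletonI, of x] V(4)[of x] by linarith
  qed
  moreover have "\<bar>coboundary (f i) ?u x + \<psi> i x\<bar> < \<epsilon>" if "i \<in> A" for i x
    using subordinate[OF that, unfolded subordinate_def]
  proof
    assume "moved (f i) \<subseteq> open_segment (p m) (f m (p m))"
    then have "coboundary (f i) ?u x = coboundary (f i) (\<lambda>x. uA x + w x) x"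
      by (intro coboundary_cong_moved[OF bij_is_inj[OF bij]] on_segment) blast
    also have "\<dots> = coboundary (f i) uA x + coboundary (f i) w x" by (rule coboundary_add)
    finally show ?thesis using approx_solutionD(3)[OF uA that, of x] w[OF that, of x] by linarith
  next
    assume "moved (f i) \<inter> moved (f m) = {}"
    then have "coboundary (f i) ?u x = coboundary (f i) uA x"
      by (intro coboundary_cong_moved[OF bij_is_inj[OF bij]] off_m) blast
    then show ?thesis using approx_solutionD(3)[OF uA that, of x] \<open>\<epsilon> > 0\<close> by linarith
  qed
  moreover have "uA (p m) = 0" "uA (f m (p m)) = 0"
    using uA_zero fundamental_segment_moved[of m] by (auto simp: open_segment_def)
  then have "continuous_on UNIV ?u"
    by (intro continuous_on_add continuous_on_diff approx_solutionD(1)[OF um] V(1)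
        approx_solutionD(1)[OF uA] continuous_on_cut_to_segment)
  moreover have "?u x = 0" if "\<forall>i\<in>insert m A. f i x = x" for x
    by (subst off_m) (use approx_solutionD(2)[OF uA] that in auto)
  ultimately show ?thesis by (auto simp: approx_solution_def)
qed

lemma exists_approx_solution_insert:
  assumes "finite A" "\<epsilon> > 0" and uA: "approx_solution (\<epsilon>/2) A uA"
    and subordinate: "\<And>i. i \<in> A \<Longrightarrow> subordinate (f i) (f m) (p m)"
  shows "\<exists>u. approx_solution \<epsilon> (insert m A) u"
proof -
  obtain um where um: "approx_solution (\<epsilon>/2) {m} um"
    using exists_approx_solution_singleton half_gt_zero[OF \<open>\<epsilon> > 0\<close>] .
  have endpoints_fixed: "f i (p m) = p m" "f i (f m (p m)) = f m (p m)" if "i \<in> A" for i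
    using subordinate[OF that, unfolded subordinate_def] fundamental_segment_moved[of m]
    by (auto simp: open_segment_def)
  obtain w where w: "continuous_on UNIV w" "w (p m) = um (p m)" "w (f m (p m)) = um (f m (p m))"
      "\<And>g x. g \<in> f ` A \<Longrightarrow> \<bar>coboundary g w x\<bar> < \<epsilon>/2"
    by (rule exists_almost_invariant_interpolation[of "f ` A" "p m" "f m (p m)" "\<epsilon>/2"])
      (use \<open>finite A\<close> \<open>\<epsilon> > 0\<close> bij lipschitz lipschitz_inv endpoints_fixed
        base_point_moved[of m] in auto)
  obtain V where V: "continuous_on UNIV V"
      "\<And>x. x \<in> fundamental_segment m \<Longrightarrow> V x = uA x + w x - um x"
      "\<And>x. f m x = x \<Longrightarrow> V x = 0" "\<And>x. \<bar>coboundary (f m) V x\<bar> < \<epsilon>/2"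
  proof (rule exists_almost_invariant_extension_from_fundamental_segment[OF strict_mono
        base_point_moved homeomorphism_inv])
    show "continuous_on UNIV (\<lambda>x. uA x + w x - um x)"
      by (intro continuous_intros approx_solutionD(1)[OF uA] approx_solutionD(1)[OF um] w(1))
    show "uA (p m) + w (p m) - um (p m) = 0" "uA (f m (p m)) + w (f m (p m)) - um (f m (p m)) = 0"
      using approx_solutionD(2)[OF uA] endpoints_fixed w(2,3) by simp_all
    show "\<epsilon>/2 > 0" using \<open>\<epsilon> > 0\<close> by simp
  qed blast
  show ?thesis
    using approx_solution_glue[OF \<open>\<epsilon> > 0\<close> uA um subordinate V] w(4) by blast
qed

lemma exists_approx_solution:
  assumes "finite A" "\<epsilon> > 0"
  shows "\<exists>u. approx_solution \<epsilon> A u"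
  using assms
proof (induction A arbitrary: \<epsilon>
    rule: finite_ranking_induct[where f = "\<lambda>i. \<bar>f i (p i) - p i\<bar>"])
  case empty
  show ?case by (intro exI[of _ "\<lambda>_. 0"]) (simp add: approx_solution_def)
next
  case (insert m A)
  show ?case
  proof (cases "m \<in> A")
    case True
    then show ?thesis using insert by (simp add: insert_absorb)
  next
    case False
    obtain uA where "approx_solution (\<epsilon>/2) A uA"
      using insert.IH[of "\<epsilon>/2"] insert.prems by auto
    then show ?thesis
      using False insert.hyps insert.prems
      by (intro exists_approx_solution_insert subordinate_longest) auto
  qed
qed

end

section \<open>Diffeomorphisms of the unit interval and logarithmic derivatives\<close>

text \<open>Off the unit interval \<open>d1\<close> is junk (every number is a derivative within \<open>{0..1}\<close> there), while
  the maps themselves are the identity; hence the value 0.\<close>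

definition log_deriv :: "(real \<Rightarrow> real) \<Rightarrow> real \<Rightarrow> real" where
  "log_deriv f x = (if x \<in> {0..1} then ln (d1 f x) else 0)"

lemma log_deriv_outside: "x \<notin> {0..1} \<Longrightarrow> log_deriv f x = 0"
  unfolding log_deriv_def by (rule if_not_P)

lemma d1_eqI:
  assumes "(f has_real_derivative d) (at x within {0..1})" "x \<in> {0..1}"
  shows "d1 f x = d"
proof -
  have "e = d" if "(f has_real_derivative e) (at x within {0..1})" for e
    using vector_derivative_unique_within_closed_interval[of 0 1 x f e d] assms that
    by (simp add: has_real_derivative_iff_has_vector_derivative)
  then show ?thesis unfolding d1_def using assms(1) by blast
qed

lemma log_deriv_eqI:
  assumes "(f has_real_derivative exp l) (at x within {0..1})" "x \<in> {0..1}"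
  shows "log_deriv f x = l"
  using d1_eqI[OF assms] assms(2) by (simp add: log_deriv_def)

lemma diff1p_has_d1:
  assumes "diff1p f" "x \<in> {0..1}"
  shows "(f has_real_derivative d1 f x) (at x within {0..1})" "d1 f x > 0"
proof -
  obtain D where "(f has_real_derivative D) (at x within {0..1})" "D > 0"
    using assms unfolding diff1p_def by blast
  then show "(f has_real_derivative d1 f x) (at x within {0..1})" "d1 f x > 0"
    using d1_eqI assms(2) by simp_all
qed

lemma diff1p_d1_eq_exp: "diff1p f \<Longrightarrow> x \<in> {0..1} \<Longrightarrow> d1 f x = exp (log_deriv f x)"
  by (simp add: log_deriv_def diff1p_has_d1(2) del: atLeastAtMost_iff)

lemma diff1p_has_log_deriv:
  "diff1p f \<Longrightarrow> x \<in> {0..1} \<Longrightarrow> (f has_real_derivative exp (log_deriv f x)) (at x within {0..1})"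
  using diff1p_has_d1(1) by (simp only: diff1p_d1_eq_exp)

lemma diff1p_continuous_on_log_deriv:
  assumes "diff1p f"
  shows "continuous_on {0..1} (log_deriv f)"
proof -
  obtain D where D: "continuous_on {0..1} D"
      "\<And>x. x \<in> {0..1} \<Longrightarrow> (f has_real_derivative D x) (at x within {0..1}) \<and> D x > 0"
    using assms unfolding diff1p_def by blast
  then have "continuous_on {0..1} (\<lambda>x. ln (D x))"
    by (intro continuous_on_ln) (auto simp: less_le)
  moreover have "ln (D x) = log_deriv f x" if "x \<in> {0..1}" for x
    using d1_eqI[of f "D x"] D(2)[OF that] that by (simp add: log_deriv_def)
  ultimately show ?thesis by (rule continuous_on_eq)
qed

lemma diff1p_fixes_outside: "diff1p f \<Longrightarrow> x \<notin> {0..1} \<Longrightarrow> f x = x"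
  by (simp add: diff1p_def)

lemma diff1p_image: "diff1p f \<Longrightarrow> f ` {0..1} = {0..1}"
  by (simp add: diff1p_def bij_betw_def)

lemma diff1p_in_unit_interval: "diff1p f \<Longrightarrow> x \<in> {0..1} \<Longrightarrow> f x \<in> {0..1}"
  using diff1p_image by blast

lemma diff1p_bij:
  assumes "diff1p f"
  shows "bij f"
proof -
  have "bij_betw f {0..1} {0..1}" using assms by (simp add: diff1p_def)
  moreover have "bij_betw f (- {0..1}) (- {0..1})"
    using bij_betw_id[of "- {0..1}"] diff1p_fixes_outside[OF assms]
    by (subst bij_betw_cong[where g = id]) auto
  ultimately have "bij_betw f ({0..1} \<union> - {0..1}) ({0..1} \<union> - {0..1})"
    by (rule bij_betw_combine) blast
  then show ?thesis by simp
qed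

lemma diff1p_inv_image: "diff1p f \<Longrightarrow> inv f ` {0..1} = {0..1}"
  using image_inv_f_f[OF bij_is_inj[OF diff1p_bij]] diff1p_image by metis

lemma diff1p_strict_mono:
  assumes "diff1p f"
  shows "strict_mono f"
proof -
  have "f x \<le> f y" if "x \<le> y" for x y
  proof -
    have "f x \<le> f y" if "x \<in> {0..1}" "y \<in> {0..1}"
      using assms that \<open>x \<le> y\<close> by (auto simp: diff1p_def monotone_on_def)
    moreover note diff1p_fixes_outside[OF assms, of x] diff1p_fixes_outside[OF assms, of y]
      diff1p_in_unit_interval[OF assms, of x] diff1p_in_unit_interval[OF assms, of y]
    ultimately show ?thesis
      using that by (cases "x \<in> {0..1}"; cases "y \<in> {0..1}") auto
  qed
  then show ?thesis
    using bij_is_inj[OF diff1p_bij[OF assms]] by (simp add: strict_mono_iff_mono mono_def)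
qed

lemma diff1p_endpoints:
  assumes "diff1p f"
  shows "f 0 = 0" "f 1 = 1"
proof -
  have "0 \<in> f ` {0..1}" "1 \<in> f ` {0..1}" using diff1p_image[OF assms] by auto
  then obtain x y where "x \<in> {0..1}" "f x = 0" "y \<in> {0..1}" "f y = 1"
    by (metis imageE)
  then have "f 0 \<le> 0" "1 \<le> f 1"
    using strict_mono_less_eq[OF diff1p_strict_mono[OF assms], of 0 x]
      strict_mono_less_eq[OF diff1p_strict_mono[OF assms], of y 1] by auto
  then show "f 0 = 0" "f 1 = 1"
    using diff1p_in_unit_interval[OF assms, of 0] diff1p_in_unit_interval[OF assms, of 1] by auto
qed

lemma less_if_has_positive_derivative_within:
  fixes f :: "real \<Rightarrow> real"
  assumes deriv: "\<And>z. z \<in> {a..b} \<Longrightarrow> (f has_real_derivative f' z) (at z within {a..b}) \<and> f' z > 0"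
    and "x \<in> {a..b}" "y \<in> {a..b}" "x < y"
  shows "f x < f y"
proof (rule DERIV_pos_imp_increasing_open[OF \<open>x < y\<close>])
  show "\<exists>d. (f has_real_derivative d) (at z) \<and> d > 0" if "x < z" "z < y" for z
    using deriv[of z] assms(2,3) that at_within_Icc_at[of a z b] by auto
  have "continuous_on {a..b} f"
    using deriv DERIV_continuous_on by blast
  then show "continuous_on {x..y} f"
    by (rule continuous_on_subset) (use assms(2,3) in auto)
qed

lemma diff1pI:
  assumes image: "f ` {0..1} = {0..1}" and outside: "\<And>x. x \<notin> {0..1} \<Longrightarrow> f x = x"
    and deriv: "\<And>x. x \<in> {0..1} \<Longrightarrow> (f has_real_derivative exp (l x)) (at x within {0..1})"
    and "continuous_on {0..1} l"
  shows "diff1p f"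
proof -
  have less: "f x < f y" if "x \<in> {0..1}" "y \<in> {0..1}" "x < y" for x y
    by (rule less_if_has_positive_derivative_within[OF _ that]) (use deriv in auto)
  then have "mono_on {0..1} f" by (force simp: monotone_on_def le_less)
  moreover have "bij_betw f {0..1} {0..1}"
    using less image by (intro bij_betw_imageI linorder_inj_onI') force+
  moreover have "continuous_on {0..1} (\<lambda>x. exp (l x))"
    using assms(4) by (intro continuous_intros)
  ultimately show ?thesis using deriv outside unfolding diff1p_def by auto
qed

lemma diff1p_comp_derivative:
  assumes "diff1p f" "diff1p g" "x \<in> {0..1}"
  shows "(f \<circ> g has_real_derivative exp (log_deriv f (g x) + log_deriv g x)) (at x within {0..1})"
  unfolding exp_add using assms
  by (intro DERIV_image_chain)
    (simp_all only: diff1p_image diff1p_has_log_deriv diff1p_in_unit_interval)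

lemma diff1p_comp:
  assumes "diff1p f" "diff1p g"
  shows "diff1p (f \<circ> g)"
proof (rule diff1pI[OF _ _ diff1p_comp_derivative[OF assms]])
  show "(f \<circ> g) ` {0..1} = {0..1}"
    using assms by (metis image_comp diff1p_image)
  show "(f \<circ> g) x = x" if "x \<notin> {0..1}" for x
    using assms that by (simp add: diff1p_fixes_outside)
  have "continuous_on {0..1} g"
    using diff1p_has_d1(1)[OF assms(2)] by (rule DERIV_continuous_on)
  then show "continuous_on {0..1} (\<lambda>x. log_deriv f (g x) + log_deriv g x)"
    using assms diff1p_in_unit_interval[OF assms(2)]
    by (intro continuous_on_add diff1p_continuous_on_log_deriv
        continuous_on_compose2[OF diff1p_continuous_on_log_deriv[OF assms(1)]]) auto
qed

lemma log_deriv_comp: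
  assumes "diff1p f" "diff1p g"
  shows "log_deriv (f \<circ> g) x = log_deriv f (g x) + log_deriv g x"
proof (cases "x \<in> {0..1}")
  case True
  then show ?thesis using diff1p_comp_derivative[OF assms] log_deriv_eqI by blast
next
  case False
  then show ?thesis
    using diff1p_fixes_outside[OF assms(2) False]
    by (simp add: log_deriv_outside del: atLeastAtMost_iff)
qed

lemma has_real_derivative_inverse_within:
  fixes f g :: "real \<Rightarrow> real"
  assumes "(f has_real_derivative d) (at x within S)" "d \<noteq> 0" "compact S" "x \<in> S"
    and "continuous_on S f" and inverse: "\<And>x. x \<in> S \<Longrightarrow> g (f x) = x"
  shows "(g has_real_derivative inverse d) (at (f x) within f ` S)"
proof -
  have "continuous_on (f ` S) g"
    using assms by (intro continuous_on_inv) auto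
  then have "continuous (at (f x) within f ` S) g"
    using \<open>x \<in> S\<close> unfolding continuous_on_eq_continuous_within by blast
  then show ?thesis
    using assms unfolding has_field_derivative_def
    by (intro has_derivative_inverse_within[where f' = "(*) d"])
      (auto simp: fun_eq_iff intro!: bounded_linear.linear bounded_linear_mult_right)
qed

lemma diff1p_inv_derivative:
  assumes "diff1p f" "x \<in> {0..1}"
  shows "(inv f has_real_derivative exp (- log_deriv f (inv f x))) (at x within {0..1})"
proof -
  define y where "y = inv f x"
  have y: "y \<in> {0..1}" "f y = x"
    using diff1p_inv_image[OF assms(1)] diff1p_bij[OF assms(1)] assms(2)
    by (auto simp: y_def bij_is_surj surj_f_inv_f)
  have "continuous_on {0..1} f"
    using diff1p_has_d1(1)[OF assms(1)] by (rule DERIV_continuous_on)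
  then have "(inv f has_real_derivative inverse (exp (log_deriv f y))) (at (f y) within f ` {0..1})"
    using diff1p_bij[OF assms(1)]
    by (intro has_real_derivative_inverse_within diff1p_has_log_deriv[OF assms(1)] y(1))
      (simp_all add: bij_is_inj)
  then show ?thesis by (simp add: y diff1p_image[OF assms(1)] exp_minus flip: y_def)
qed

lemma diff1p_inv:
  assumes "diff1p f"
  shows "diff1p (inv f)"
proof (rule diff1pI[OF _ _ diff1p_inv_derivative[OF assms]])
  show "inv f ` {0..1} = {0..1}" by (rule diff1p_inv_image[OF assms])
  show "inv f x = x" if "x \<notin> {0..1}" for x
    using diff1p_fixes_outside[OF assms that] bij_is_inj[OF diff1p_bij[OF assms]]
    by (rule inv_f_eq[rotated])
  have "continuous_on {0..1} (inv f)"
    using diff1p_inv_derivative[OF assms] by (rule DERIV_continuous_on)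
  then show "continuous_on {0..1} (\<lambda>x. - log_deriv f (inv f x))"
    using diff1p_inv_image[OF assms]
    by (intro continuous_on_minus
        continuous_on_compose2[OF diff1p_continuous_on_log_deriv[OF assms]]) auto
qed

lemma log_deriv_inv:
  assumes "diff1p f"
  shows "log_deriv (inv f) x = - log_deriv f (inv f x)"
proof (cases "x \<in> {0..1}")
  case True
  then show ?thesis using diff1p_inv_derivative[OF assms] log_deriv_eqI by blast
next
  case False
  then show ?thesis
    using diff1p_fixes_outside[OF diff1p_inv[OF assms] False]
    by (simp add: log_deriv_outside del: atLeastAtMost_iff)
qed

definition conjugate_by :: "('a \<Rightarrow> 'b) \<Rightarrow> ('a \<Rightarrow> 'a) \<Rightarrow> 'b \<Rightarrow> 'b" where
  "conjugate_by h g = h \<circ> g \<circ> inv h"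

lemma conjugate_by_id: "surj h \<Longrightarrow> conjugate_by h id = id"
  by (simp add: conjugate_by_def fun_eq_iff surj_f_inv_f)

lemma conjugate_by_comp: "inj h \<Longrightarrow> conjugate_by h (f \<circ> g) = conjugate_by h f \<circ> conjugate_by h g"
  by (simp add: conjugate_by_def fun_eq_iff)

lemma conjugate_by_inv:
  assumes "bij h" "bij f"
  shows "conjugate_by h (inv f) = inv (conjugate_by h f)"
  unfolding conjugate_by_def using assms
  by (simp add: o_inv_distrib bij_comp bij_imp_bij_inv inv_inv_eq comp_assoc)

lemma diff1p_conjugate_by: "diff1p h \<Longrightarrow> diff1p g \<Longrightarrow> diff1p (conjugate_by h g)"
  unfolding conjugate_by_def by (intro diff1p_comp diff1p_inv)

lemma log_deriv_conjugate_by: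
  assumes "diff1p h" "diff1p g"
  shows "log_deriv (conjugate_by h g) x =
    coboundary g (log_deriv h) (inv h x) + log_deriv g (inv h x)"
  using assms
  by (simp add: conjugate_by_def log_deriv_comp log_deriv_inv diff1p_comp diff1p_inv coboundary_def)

lemma diff1p_id: "diff1p id"
  by (rule diff1pI[where l = "\<lambda>_. 0"]) (auto simp: id_def)

lemma diff1p_gen_group:
  assumes "\<And>f. f \<in> F \<Longrightarrow> diff1p f" "g \<in> gen_group F"
  shows "diff1p g"
  using assms(2)
proof induction
  case gen_id
  show ?case by (rule diff1p_id)
next
  case (gen_mult g f)
  then show ?case using assms(1) by (intro diff1p_comp)
next
  case (gen_inv g f)
  then show ?case using assms(1) by (intro diff1p_comp diff1p_inv)
qed

lemma exists_diff1p_with_log_deriv: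
  assumes "continuous_on {0..1} u"
  shows "\<exists>h c. diff1p h \<and> (\<forall>x\<in>{0..1}. log_deriv h x = u x + c)"
proof -
  have "continuous_on {0..1} (\<lambda>x. exp (u x))"
    using assms by (intro continuous_intros)
  then obtain E where "\<And>x. x \<in> {0..1} \<Longrightarrow> (E has_vector_derivative exp (u x)) (at x within {0..1})"
    using antiderivative_continuous by blast
  then have E: "(E has_real_derivative exp (u x)) (at x within {0..1})" if "x \<in> {0..1}" for x
    using that by (simp add: has_real_derivative_iff_has_vector_derivative)
  have "E 0 < E 1"
    by (rule less_if_has_positive_derivative_within[of 0 1]) (use E in auto)
  define h where "h x = (if x \<in> {0..1} then (E x - E 0) / (E 1 - E 0) else x)" for x
  define c where "c = - ln (E 1 - E 0)"
  have deriv: "(h has_real_derivative exp (u x + c)) (at x within {0..1})" if "x \<in> {0..1}" for x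
  proof (rule has_field_derivative_transform_within[OF _ zero_less_one that])
    show "((\<lambda>x. (E x - E 0) / (E 1 - E 0)) has_real_derivative exp (u x + c)) (at x within {0..1})"
      using E[OF that] \<open>E 0 < E 1\<close>
      by (auto intro!: derivative_eq_intros simp: c_def exp_diff)
  qed (simp add: h_def)
  have h01: "h 0 = 0" "h 1 = 1" using \<open>E 0 < E 1\<close> by (auto simp: h_def)
  have less: "h x < h y" if "x \<in> {0..1}" "y \<in> {0..1}" "x < y" for x y
    by (rule less_if_has_positive_derivative_within[OF _ that]) (use deriv in auto)
  have "continuous_on {0..1} h" using deriv by (rule DERIV_continuous_on)
  have "h ` {0..1} = {0..1}"
  proof
    show "h ` {0..1} \<subseteq> {0..1}" using less[of 0] less[of _ 1] h01 by (force simp: le_less)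
    show "{0..1} \<subseteq> h ` {0..1}"
      using IVT'[of h 0 _ 1] \<open>continuous_on {0..1} h\<close> h01 by force
  qed
  moreover have "h x = x" if "x \<notin> {0..1}" for x using that unfolding h_def by (rule if_not_P)
  moreover have "continuous_on {0..1} (\<lambda>x. u x + c)"
    using assms by (intro continuous_intros)
  ultimately have "diff1p h" using deriv by (intro diff1pI)
  then show ?thesis using log_deriv_eqI[OF deriv] by blast
qed

lemma clamp_unit_interval_outside: "x \<notin> {0..1::real} \<Longrightarrow> clamp 0 1 x = 0 \<or> clamp 0 1 x = 1"
  by (auto simp: clamp_def)

lemma diff1p_lipschitz:
  assumes "diff1p f"
  obtains L where "L-lipschitz_on UNIV f"
proof -
  have "bounded (log_deriv f ` {0..1})"
    by (intro compact_imp_bounded compact_continuous_image diff1p_continuous_on_log_deriv[OF assms])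
      simp
  then obtain B where "\<forall>x\<in>{0..1}. \<bar>log_deriv f x\<bar> \<le> B"
    unfolding bounded_iff by auto
  then have B: "log_deriv f x \<le> B" if "x \<in> {0..1}" for x
    using that abs_le_D1 by blast
  have "(exp B)-lipschitz_on {0..1} f"
  proof (rule lipschitz_onI)
    show "dist (f x) (f y) \<le> exp B * dist x y" if "x \<in> {0..1}" "y \<in> {0..1}" for x y
      unfolding dist_norm
      by (rule field_differentiable_bound[OF convex_real_interval(5)
            diff1p_has_log_deriv[OF assms] _ that]) (use B in auto)
  qed simp
  then have "(exp B)-lipschitz_on (clamp 0 1 ` UNIV) f"
    by (rule lipschitz_on_subset) (use clamp_in_interval[of 0 "1::real"] in auto)
  moreover have clamp: "1-lipschitz_on UNIV (clamp 0 (1::real))"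
    by (rule lipschitz_onI) (simp_all add: dist_clamps_le_dist_args)
  ultimately have "(exp B * 1)-lipschitz_on UNIV (\<lambda>x. f (clamp 0 1 x))"
    by (intro lipschitz_on_compose2)
  moreover have "f (clamp 0 1 x) + (x - clamp 0 1 x) = f x" for x
    using clamp_unit_interval_outside[of x] diff1p_endpoints[OF assms]
      diff1p_fixes_outside[OF assms, of x] by (cases "x \<in> {0..1}") auto
  ultimately have "(exp B * 1 + (1 + 1))-lipschitz_on UNIV f"
    using lipschitz_on_add[OF _ lipschitz_on_diff[OF lipschitz_on_id clamp],
        of "exp B * 1" "\<lambda>x. f (clamp 0 1 x)"] by simp
  then show ?thesis by (rule that)
qed

lemma log_deriv_fixed_point:
  assumes "no_hyperbolic_fixed_points f" "f x = x"
  shows "log_deriv f x = 0"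
proof (cases "x \<in> {0..1}")
  case True
  then have "(f has_real_derivative exp 0) (at x within {0..1})"
    using assms by (simp add: no_hyperbolic_fixed_points_def)
  then show ?thesis using True by (rule log_deriv_eqI)
qed (rule log_deriv_outside)

lemma continuous_on_log_deriv:
  assumes "diff1p f" "no_hyperbolic_fixed_points f"
  shows "continuous_on UNIV (log_deriv f)"
proof -
  have "ext_cont (log_deriv f) 0 1 x = log_deriv f x" for x
  proof (cases "x \<in> {0..1}")
    case False
    then show ?thesis
      using clamp_unit_interval_outside[OF False] log_deriv_outside[OF False]
        log_deriv_fixed_point[OF assms(2)] diff1p_endpoints[OF assms(1)]
      by (auto simp: ext_cont_def)
  qed simp
  then show ?thesis
    using continuous_on_ext_cont[of 0 1 "log_deriv f" UNIV]
      diff1p_continuous_on_log_deriv[OF assms(1)] by (simp add: ext)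
qed

section \<open>Convergence to the identity\<close>

lemma uniform_limit_isCont_compose:
  assumes "uniform_limit S \<phi> (\<lambda>_. c) F" "isCont g c"
  shows "uniform_limit S (\<lambda>n x. g (\<phi> n x)) (\<lambda>_. g c) F"
proof (rule uniform_limitI)
  fix \<epsilon> :: real assume "\<epsilon> > 0"
  then obtain \<delta> where "\<delta> > 0" and \<delta>: "\<And>y. dist y c < \<delta> \<Longrightarrow> dist (g y) (g c) < \<epsilon>"
    using assms(2) unfolding continuous_at_eps_delta by blast
  from uniform_limitD[OF assms(1) \<open>\<delta> > 0\<close>]
  show "\<forall>\<^sub>F n in F. \<forall>x\<in>S. dist (g (\<phi> n x)) (g c) < \<epsilon>"
    by (rule eventually_mono) (simp add: \<delta>)
qed

lemma uniform_limit_precompose: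
  assumes "uniform_limit S \<phi> (\<lambda>_. c) F" "\<And>n x. x \<in> S \<Longrightarrow> g n x \<in> S"
  shows "uniform_limit S (\<lambda>n x. \<phi> n (g n x)) (\<lambda>_. c) F"
proof (rule uniform_limitI)
  fix \<epsilon> :: real assume "\<epsilon> > 0"
  with uniform_limitD[OF assms(1)] have "\<forall>\<^sub>F n in F. \<forall>x\<in>S. dist (\<phi> n x) c < \<epsilon>" .
  then show "\<forall>\<^sub>F n in F. \<forall>x\<in>S. dist (\<phi> n (g n x)) c < \<epsilon>"
    using assms(2) by (auto elim!: eventually_mono)
qed

lemma abs_diff_id_le_if_d1_near_1:
  assumes "diff1p \<phi>" and d1: "\<And>x. x \<in> {0..1} \<Longrightarrow> \<bar>d1 \<phi> x - 1\<bar> \<le> \<delta>" and "x \<in> {0..1}"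
  shows "\<bar>\<phi> x - x\<bar> \<le> \<delta>"
proof -
  have "((\<lambda>x. \<phi> x - x) has_real_derivative d1 \<phi> y - 1) (at y within {0..1})" if "y \<in> {0..1}" for y
    using diff1p_has_d1(1)[OF assms(1) that] by (auto intro!: derivative_eq_intros)
  then have "norm ((\<phi> x - x) - (\<phi> 0 - 0)) \<le> \<delta> * norm (x - 0)"
    by (rule field_differentiable_bound[OF convex_real_interval(5)]) (use d1 assms(3) in auto)
  also have "\<dots> \<le> \<delta> * 1"
    using d1[OF assms(3)] assms(3) by (intro mult_left_mono) auto
  finally show ?thesis using diff1p_endpoints[OF assms(1)] by simp
qed

lemma C1_tendsto_id_iff_d1:
  assumes "\<And>n. diff1p (\<phi> n)"
  shows "C1_tendsto_id \<phi> \<longleftrightarrow> uniform_limit {0..1} (\<lambda>n. d1 (\<phi> n)) (\<lambda>_. 1) sequentially"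
proof
  assume "C1_tendsto_id \<phi>"
  then show "uniform_limit {0..1} (\<lambda>n. d1 (\<phi> n)) (\<lambda>_. 1) sequentially"
    by (auto simp: C1_tendsto_id_def uniform_limit_iff dist_real_def elim!: eventually_mono)
next
  assume lim: "uniform_limit {0..1} (\<lambda>n. d1 (\<phi> n)) (\<lambda>_. 1) sequentially"
  show "C1_tendsto_id \<phi>"
    unfolding C1_tendsto_id_def
  proof (intro allI impI)
    fix \<epsilon> :: real assume "\<epsilon> > 0"
    from uniform_limitD[OF lim half_gt_zero[OF this]]
    show "\<forall>\<^sub>F n in sequentially. \<forall>x\<in>{0..1}. \<bar>\<phi> n x - x\<bar> < \<epsilon> \<and> \<bar>d1 (\<phi> n) x - 1\<bar> < \<epsilon>"
    proof eventually_elim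
      case (elim n)
      then have d1: "\<bar>d1 (\<phi> n) x - 1\<bar> \<le> \<epsilon>/2" if "x \<in> {0..1}" for x
        using that by (force simp: dist_real_def)
      then have "\<bar>\<phi> n x - x\<bar> \<le> \<epsilon>/2" if "x \<in> {0..1}" for x
        using abs_diff_id_le_if_d1_near_1[OF assms] that by blast
      then show ?case using d1 \<open>\<epsilon> > 0\<close> by force
    qed
  qed
qed

lemma C1_tendsto_id_iff_log_deriv:
  assumes "\<And>n. diff1p (\<phi> n)"
  shows "C1_tendsto_id \<phi> \<longleftrightarrow> uniform_limit {0..1} (\<lambda>n. log_deriv (\<phi> n)) (\<lambda>_. 0) sequentially"
  unfolding C1_tendsto_id_iff_d1[OF assms]
proof
  assume "uniform_limit {0..1} (\<lambda>n. d1 (\<phi> n)) (\<lambda>_. 1) sequentially"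
  then have "uniform_limit {0..1} (\<lambda>n x. ln (d1 (\<phi> n) x)) (\<lambda>_. ln 1) sequentially"
    by (rule uniform_limit_isCont_compose) (simp add: isCont_ln)
  then show "uniform_limit {0..1} (\<lambda>n. log_deriv (\<phi> n)) (\<lambda>_. 0) sequentially"
    by (rule uniform_limit_cong'[THEN iffD1, rotated 2]) (simp_all add: log_deriv_def)
next
  assume "uniform_limit {0..1} (\<lambda>n. log_deriv (\<phi> n)) (\<lambda>_. 0) sequentially"
  then have "uniform_limit {0..1} (\<lambda>n x. exp (log_deriv (\<phi> n) x)) (\<lambda>_. exp 0) sequentially"
    by (rule uniform_limit_isCont_compose) simp
  then show "uniform_limit {0..1} (\<lambda>n. d1 (\<phi> n)) (\<lambda>_. 1) sequentially"
    by (rule uniform_limit_cong'[THEN iffD1, rotated 2]) (simp_all add: diff1p_d1_eq_exp[OF assms])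
qed

lemma C1_tendsto_id_comp:
  assumes "\<And>n. diff1p (\<phi> n)" "\<And>n. diff1p (\<theta> n)" "C1_tendsto_id \<phi>" "C1_tendsto_id \<theta>"
  shows "C1_tendsto_id (\<lambda>n. \<phi> n \<circ> \<theta> n)"
proof -
  have lim: "uniform_limit {0..1} (\<lambda>n. log_deriv (\<phi> n)) (\<lambda>_. 0) sequentially"
      "uniform_limit {0..1} (\<lambda>n. log_deriv (\<theta> n)) (\<lambda>_. 0) sequentially"
    using assms(3,4) unfolding C1_tendsto_id_iff_log_deriv[OF assms(1)]
      C1_tendsto_id_iff_log_deriv[OF assms(2)] .
  have "uniform_limit {0..1} (\<lambda>n x. log_deriv (\<phi> n) (\<theta> n x)) (\<lambda>_. 0) sequentially"
    by (rule uniform_limit_precompose[OF lim(1) diff1p_in_unit_interval[OF assms(2)]])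
  from uniform_limit_add[OF this lim(2)]
  have "uniform_limit {0..1} (\<lambda>n. log_deriv (\<phi> n \<circ> \<theta> n)) (\<lambda>_. 0) sequentially"
    by (simp add: log_deriv_comp[OF assms(1,2), abs_def])
  then show ?thesis
    using assms(1,2) by (simp only: C1_tendsto_id_iff_log_deriv diff1p_comp)
qed

lemma C1_tendsto_id_inv:
  assumes "\<And>n. diff1p (\<phi> n)" "C1_tendsto_id \<phi>"
  shows "C1_tendsto_id (\<lambda>n. inv (\<phi> n))"
proof -
  have "uniform_limit {0..1} (\<lambda>n. log_deriv (\<phi> n)) (\<lambda>_. 0) sequentially"
    using assms(2) unfolding C1_tendsto_id_iff_log_deriv[OF assms(1)] .
  then have "uniform_limit {0..1} (\<lambda>n x. log_deriv (\<phi> n) (inv (\<phi> n) x)) (\<lambda>_. 0) sequentially"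
    by (rule uniform_limit_precompose) (rule diff1p_in_unit_interval[OF diff1p_inv[OF assms(1)]])
  from uniform_limit_uminus[OF this]
  have "uniform_limit {0..1} (\<lambda>n. log_deriv (inv (\<phi> n))) (\<lambda>_. 0) sequentially"
    by (simp add: log_deriv_inv[OF assms(1), abs_def])
  then show ?thesis
    using assms(1) by (simp only: C1_tendsto_id_iff_log_deriv diff1p_inv)
qed

lemma C1_tendsto_id_const_id: "C1_tendsto_id (\<lambda>_. id)"
proof -
  have "log_deriv id x = 0" if "x \<in> {0..1}" for x
    using that by (intro log_deriv_eqI) (auto simp: id_def)
  then show ?thesis
    by (subst C1_tendsto_id_iff_log_deriv) (auto simp: uniform_limit_iff diff1p_id)
qed

lemma C1_tendsto_id_conjugates_gen_group:
  assumes h: "\<And>n. diff1p (h n)" and F: "\<And>f. f \<in> F \<Longrightarrow> diff1p f"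
    and lim: "\<And>f. f \<in> F \<Longrightarrow> C1_tendsto_id (\<lambda>n. conjugate_by (h n) f)"
    and "g \<in> gen_group F"
  shows "C1_tendsto_id (\<lambda>n. conjugate_by (h n) g)"
  using \<open>g \<in> gen_group F\<close>
proof induction
  case gen_id
  then show ?case
    by (simp only: conjugate_by_id[OF bij_is_surj[OF diff1p_bij[OF h]]] C1_tendsto_id_const_id)
next
  case (gen_mult g f)
  have "C1_tendsto_id (\<lambda>n. conjugate_by (h n) f \<circ> conjugate_by (h n) g)"
    using gen_mult lim h F diff1p_gen_group[of F]
    by (intro C1_tendsto_id_comp diff1p_conjugate_by) auto
  then show ?case by (simp only: conjugate_by_comp bij_is_inj diff1p_bij h)
next
  case (gen_inv g f)
  have "C1_tendsto_id (\<lambda>n. inv (conjugate_by (h n) f) \<circ> conjugate_by (h n) g)"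
    using gen_inv lim h F diff1p_gen_group[of F]
    by (intro C1_tendsto_id_comp C1_tendsto_id_inv diff1p_inv diff1p_conjugate_by) auto
  then show ?case
    using gen_inv.hyps(2)
    by (simp only: conjugate_by_comp conjugate_by_inv bij_is_inj diff1p_bij h F)
qed

lemma C1_tendsto_id_conjugates_if_almost_coboundary:
  assumes h: "\<And>n. diff1p (h n)" "\<And>n x. x \<in> {0..1} \<Longrightarrow> log_deriv (h n) x = u n x + c n"
    and g: "diff1p g"
    and lim: "uniform_limit {0..1} (\<lambda>n x. coboundary g (u n) x + log_deriv g x) (\<lambda>_. 0)
      sequentially"
  shows "C1_tendsto_id (\<lambda>n. conjugate_by (h n) g)"
proof -
  have in01: "inv (h n) x \<in> {0..1}" if "x \<in> {0..1}" for n x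
    using diff1p_inv[OF h(1)] that by (rule diff1p_in_unit_interval)
  have log_deriv_eq: "log_deriv (conjugate_by (h n) g) x =
      coboundary g (u n) (inv (h n) x) + log_deriv g (inv (h n) x)" if "x \<in> {0..1}" for n x
    using h(2) in01[OF that] diff1p_in_unit_interval[OF g in01[OF that]]
    by (simp add: log_deriv_conjugate_by[OF h(1) g] coboundary_def)
  have "uniform_limit {0..1}
      (\<lambda>n x. coboundary g (u n) (inv (h n) x) + log_deriv g (inv (h n) x)) (\<lambda>_. 0) sequentially"
    by (rule uniform_limit_precompose[OF lim in01])
  then have "uniform_limit {0..1} (\<lambda>n. log_deriv (conjugate_by (h n) g)) (\<lambda>_. 0) sequentially"
    by (rule uniform_limit_cong'[THEN iffD2, rotated 2]) (rule log_deriv_eq, simp_all)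
  then show ?thesis
    by (subst C1_tendsto_id_iff_log_deriv) (simp_all add: diff1p_conjugate_by h(1) g)
qed

lemma C1_close_to_id_if_almost_coboundaries:
  fixes f :: "nat \<Rightarrow> real \<Rightarrow> real"
  assumes f: "\<And>i. diff1p (f i)"
    and solutions: "\<And>n \<epsilon>. \<epsilon> > 0 \<Longrightarrow> \<exists>u. continuous_on {0..1} u \<and>
      (\<forall>i\<le>n. \<forall>x\<in>{0..1}. \<bar>coboundary (f i) u x + log_deriv (f i) x\<bar> < \<epsilon>)"
  shows "C1_close_to_id (gen_group (range f))"
proof -
  have "\<exists>u. continuous_on {0..1} u \<and>
      (\<forall>i\<le>n. \<forall>x\<in>{0..1}. \<bar>coboundary (f i) u x + log_deriv (f i) x\<bar> < 1 / real (Suc n))" for n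
    by (rule solutions) simp
  then obtain u where u: "\<And>n. continuous_on {0..1} (u n)"
    "\<And>n i x. i \<le> n \<Longrightarrow> x \<in> {0..1} \<Longrightarrow>
      \<bar>coboundary (f i) (u n) x + log_deriv (f i) x\<bar> < 1 / real (Suc n)"
    by metis
  have "\<exists>h c. diff1p h \<and> (\<forall>x\<in>{0..1}. log_deriv h x = u n x + c)" for n
    by (rule exists_diff1p_with_log_deriv[OF u(1)])
  then obtain h c where h: "\<And>n. diff1p (h n)"
      "\<And>n x. x \<in> {0..1} \<Longrightarrow> log_deriv (h n) x = u n x + c n"
    by metis
  have generators: "C1_tendsto_id (\<lambda>n. conjugate_by (h n) (f i))" for i
  proof (rule C1_tendsto_id_conjugates_if_almost_coboundary[OF h(1) _ f])
    show "log_deriv (h n) x = u n x + c n" if "x \<in> {0..1}" for n x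
      using that by (rule h(2))
    show "uniform_limit {0..1} (\<lambda>n x. coboundary (f i) (u n) x + log_deriv (f i) x) (\<lambda>_. 0)
        sequentially"
    proof (rule uniform_limitI)
      fix \<epsilon> :: real assume "\<epsilon> > 0"
      then have "\<forall>\<^sub>F n in sequentially. 1 / real (Suc n) < \<epsilon>"
        using LIMSEQ_Suc[OF lim_1_over_n] by (auto dest: order_tendstoD)
      then show "\<forall>\<^sub>F n in sequentially.
          \<forall>x\<in>{0..1}. dist (coboundary (f i) (u n) x + log_deriv (f i) x) 0 < \<epsilon>"
        using eventually_ge_at_top[of i]
      proof eventually_elim
        case (elim n)
        show ?case using less_trans[OF u(2)[OF elim(2)] elim(1)] by simp
      qed
    qed
  qed
  have "C1_tendsto_id (\<lambda>n. conjugate_by (h n) g)" if "g \<in> gen_group (range f)" for g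
    by (rule C1_tendsto_id_conjugates_gen_group[OF h(1) _ _ that]) (use f generators in auto)
  then show ?thesis
    using h(1) unfolding C1_close_to_id_def conjugate_by_def by blast
qed

lemma moved_subset_interior_supp:
  assumes "continuous_on UNIV f"
  shows "moved f \<subseteq> interior (supp f)"
proof (rule interior_maximal)
  show "open (moved f)" by (intro open_Collect_neq assms continuous_on_id)
qed (simp add: supp_def closure_subset)

lemma moved_subset_open_segment_if_supp_subset:
  assumes "continuous_on UNIV f" "supp f \<subseteq> closed_segment a b"
  shows "moved f \<subseteq> open_segment a b"
  using moved_subset_interior_supp[OF assms(1)] interior_mono[OF assms(2)]
  by (simp add: interior_closed_segment)

theorem theoremt2:
  fixes f :: "nat \<Rightarrow> real \<Rightarrow> real" and I :: "nat \<Rightarrow> real set"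
  assumes "\<And>n. diff1p (f n)"
    and "\<And>n. f n \<noteq> id"
    and "\<And>n. no_hyperbolic_fixed_points (f n)"
    and "\<And>n. fundamental_domain (f n) (I n)"
    and "\<And>i n. i < n \<Longrightarrow> supp (f n) \<subseteq> I i \<or> supp (f i) \<subseteq> I n \<or>
            interior (supp (f n)) \<inter> interior (supp (f i)) = {}"
  shows "C1_close_to_id (gen_group (range f))"
proof (rule C1_close_to_id_if_almost_coboundaries[OF assms(1)])
  obtain p where p: "\<And>i. f i (p i) \<noteq> p i" "\<And>i. I i = closed_segment (p i) (f i (p i))"
    using assms(4) unfolding fundamental_domain_def by metis
  have lipschitz: "\<exists>L. L-lipschitz_on UNIV (f i)" "\<exists>L. L-lipschitz_on UNIV (inv (f i))" for i
    using assms(1) diff1p_inv diff1p_lipschitz by metis+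
  then have continuous: "continuous_on UNIV (f i)" for i
    using lipschitz_on_continuous_on by blast
  have subordinate: "subordinate (f n) (f i) (p i) \<or> subordinate (f i) (f n) (p n)"
    if "i < n" for i n
    using assms(5)[OF that] moved_subset_open_segment_if_supp_subset[OF continuous]
      moved_subset_interior_supp[OF continuous] unfolding p(2) subordinate_def by blast
  interpret nested_family f "\<lambda>i. log_deriv (f i)" p 0 1
  proof
    show "subordinate (f i) (f j) (p j) \<or> subordinate (f j) (f i) (p i)" if "i \<noteq> j" for i j
      using subordinate[of i j] subordinate[of j i] that by (cases i j rule: linorder_cases) auto
  qed (fact diff1p_strict_mono[OF assms(1)] diff1p_bij[OF assms(1)]
      diff1p_fixes_outside[OF assms(1)] lipschitz continuous_on_log_deriv[OF assms(1,3)]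
      log_deriv_fixed_point[OF assms(3)] p(1))+
  show "\<exists>u. continuous_on {0..1} u \<and>
      (\<forall>i\<le>n. \<forall>x\<in>{0..1}. \<bar>coboundary (f i) u x + log_deriv (f i) x\<bar> < \<epsilon>)" if "\<epsilon> > 0" for n \<epsilon>
    using exists_approx_solution[of "{..n}" \<epsilon>] that
    unfolding approx_solution_def by (blast intro: continuous_on_subset)
qed

end
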